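(* Assume that the noise terms $\xi_i$, $i=1,\dots,n$, are centered Gaussian random variables with a given variance $\sigma^2>0$. There exists a positive constant $C_{17}$, which depends only on the dimension $d$ and on $\sigma$, such that for any $n\ge 125$ and any set estimator $\hat C$ based on $n$ observations, $$\sup_{C\in\mathcal C_d}\mathbb E_C\left[|C\triangle\hat C|\right] \geq C_{17}\,n^{-2/(d+1)}.$$
   Context: Let $d\ge 2$ be an integer. One observes $n$ i.i.d. pairs $(X_i,Y_i)$, $i=1,\dots,n$, with $X_i$ uniformly distributed on $[0,1]^d$ and $Y_i=I(X_i\in G)+\xi_i$, where $G\subseteq[0,1]^d$ is unknown, $I(\cdot\in G)$ is the indicator function of $G$, and the errors $\xi_1,\dots,\xi_n$ are i.i.d. real random variables independent of $(X_1,\dots,X_n)$. $\mathbb E_G$ denotes expectation with respect to the distribution of the $n$ pairs. $|\cdot|$ is Lebesgue measure on $\mathbb R^d$ and $\triangle$ is symmetric difference. A set estimator based on $n$ observations is a Borel subset $\hat G_n$ of $[0,1]^d$ for which there is a real measurable function $f$ with $I(\cdot\in\hat G_n)=f(\cdot,X_1,Y_1,\dots,X_n,Y_n)$. All convex sets considered are compact with nonempty interior. $\mathcal C_d$ is the class of all (compact) convex sets included in $[0,1]^d$. *)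

theory Defs
  imports "HOL-Probability.Probability"
begin

definition unit_cube :: "(real ^ 'd) set" where
  "unit_cube = {x. \<forall>i. 0 \<le> x $ i \<and> x $ i \<le> 1}"

definition convex_class :: "(real ^ 'd) set set" where
  "convex_class = {C. compact C \<and> convex C \<and> interior C \<noteq> {} \<and> C \<subseteq> unit_cube}"

definition gaussian_noise :: "real \<Rightarrow> real measure" where
  "gaussian_noise \<sigma> = density lborel (\<lambda>x. ennreal (normal_density 0 \<sigma> x))"

text \<open>Joint law of one pair \<open>(X, Y)\<close> with \<open>Y = I(X \<in> G) + \<xi>\<close>, where \<open>X\<close> is uniform on the cube
  and \<open>\<xi>\<close> has law \<open>N\<close>; the product measure encodes the independence of \<open>X\<close> and \<open>\<xi>\<close>.\<close>

definition pair_law :: "real measure \<Rightarrow> (real ^ 'd) set \<Rightarrow> ((real ^ 'd) \<times> real) measure" where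
  "pair_law N G =
     distr (uniform_measure lborel unit_cube \<Otimes>\<^sub>M N) borel
       (\<lambda>(x, \<xi>). (x, indicator G x + \<xi>))"

definition sample_law ::
    "real measure \<Rightarrow> nat \<Rightarrow> (real ^ 'd) set \<Rightarrow> (nat \<Rightarrow> (real ^ 'd) \<times> real) measure" where
  "sample_law N n G = PiM {1..n} (\<lambda>_. pair_law N G)"

abbreviation sample_space :: "nat \<Rightarrow> (nat \<Rightarrow> (real ^ 'd) \<times> real) measure" where
  "sample_space n \<equiv> PiM {1..n} (\<lambda>_. borel)"

text \<open>A set estimator is represented as a function of the sample \<open>\<omega> i = (X\<^sub>i, Y\<^sub>i)\<close>. It is required
  to be a subset of the cube for every conceivable sample, not only for those with all \<open>X\<^sub>i\<close> in the
  cube; since the latter have full measure, this does not affect the risk.\<close>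

definition set_estimator ::
    "nat \<Rightarrow> ((nat \<Rightarrow> (real ^ 'd) \<times> real) \<Rightarrow> (real ^ 'd) set) \<Rightarrow> bool" where
  "set_estimator n Ghat \<longleftrightarrow>
     (\<forall>\<omega>\<in>space (sample_space n). Ghat \<omega> \<in> sets borel \<and> Ghat \<omega> \<subseteq> unit_cube) \<and>
     (\<exists>f :: (real ^ 'd) \<times> (nat \<Rightarrow> (real ^ 'd) \<times> real) \<Rightarrow> real.
        f \<in> borel_measurable (borel \<Otimes>\<^sub>M sample_space n) \<and>
        (\<forall>\<omega>\<in>space (sample_space n). \<forall>x. indicator (Ghat \<omega>) x = f (x, \<omega>)))"

text \<open>Valued in \<open>ennreal\<close>, so that suprema of risks need no boundedness side condition.\<close>

definition risk ::
    "real measure \<Rightarrow> nat \<Rightarrow> (real ^ 'd) set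
      \<Rightarrow> ((nat \<Rightarrow> (real ^ 'd) \<times> real) \<Rightarrow> (real ^ 'd) set) \<Rightarrow> ennreal" where
  "risk N n G Ghat =
     (\<integral>\<^sup>+ \<omega>. emeasure lborel (sym_diff G (Ghat \<omega>)) \<partial>sample_law N n G)"

end

theory Submission imports Defs begin

text \<open>The lower bound comes from Assouad's hypercube argument. The base body is a paraboloid inside
  the cube; cutting off any set of caps of a grid leaves a convex set, and the caps, of height of order
  \<open>K\<^sup>-\<^sup>2\<close> over cubes of side \<open>1 / K\<close>, are disjoint. With \<open>K\<close> of order \<open>n powr (1 / (d + 1))\<close>, a given
  cap contains none of the \<open>n\<close> design points with probability at least one half, and then its
  presence is undetectable, whatever the noise. Each of the \<open>K ^ (d - 1)\<close> caps therefore contributes on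
  average a fixed fraction of its volume, of order \<open>K powr (- (d + 1))\<close>, to the risk.\<close>

subsection \<open>Caps of a paraboloid\<close>

text \<open>Averaging the translates of \<open>A\<close> along the \<open>k\<close>-axis makes the fibre lengths appear without
  splitting the space into a product and without a change of variables.\<close>

lemma emeasure_fibre:
  fixes A :: "(real ^ 'd::finite) set"
  assumes [measurable]: "A \<in> sets borel"
  shows "emeasure lborel A =
    (\<integral>\<^sup>+x. indicator {x. 0 \<le> x $ k \<and> x $ k \<le> 1} x *
      emeasure lborel {s. x + s *\<^sub>R axis k 1 \<in> A} \<partial>lborel)"
proof -
  define e :: "real ^ 'd" where "e = axis k 1"
  define W :: "real ^ 'd \<Rightarrow> ennreal" where "W = indicator {x. 0 \<le> x $ k \<and> x $ k \<le> 1}"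
  have [measurable]: "W \<in> borel_measurable borel"
    unfolding W_def by measurable
  \<comment> \<open>The admissible shifts \<open>s\<close> form the interval from
    \<open>x $ k - 1\<close> to \<open>x $ k\<close>, so the weight has total mass one along every
    line parallel to \<open>e\<close>.\<close>
  have W: "(\<integral>\<^sup>+s. W (x - s *\<^sub>R e) \<partial>lborel) = 1" for x
  proof -
    have "(\<integral>\<^sup>+s. W (x - s *\<^sub>R e) \<partial>lborel) = (\<integral>\<^sup>+s. indicator {x $ k - 1..x $ k} s \<partial>lborel)"
      by (intro nn_integral_cong) (auto simp: W_def e_def indicator_def axis_def)
    then show ?thesis
      by simp
  qed
  have "emeasure lborel A = (\<integral>\<^sup>+x. indicator A x * (\<integral>\<^sup>+s. W (x - s *\<^sub>R e) \<partial>lborel) \<partial>lborel)"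
    by (simp add: W)
  also have "\<dots> = (\<integral>\<^sup>+x. \<integral>\<^sup>+s. indicator A x * W (x - s *\<^sub>R e) \<partial>lborel \<partial>lborel)"
    by (subst nn_integral_cmult) auto
  also have "\<dots> = (\<integral>\<^sup>+s. \<integral>\<^sup>+x. indicator A x * W (x - s *\<^sub>R e) \<partial>lborel \<partial>lborel)"
    by (rule lborel_pair.Fubini') measurable
  \<comment> \<open>For fixed \<open>s\<close>, translation invariance moves the shift from the
    weight \<open>W\<close> to the set \<open>A\<close>; after a second exchange of integrals the
    inner one is a fibre length.\<close>
  also have "\<dots> = (\<integral>\<^sup>+s. \<integral>\<^sup>+x. indicator A (x + s *\<^sub>R e) * W x \<partial>lborel \<partial>lborel)"
  proof (rule nn_integral_cong)
    fix s :: real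
    have "(\<integral>\<^sup>+x. indicator A x * W (x - s *\<^sub>R e) \<partial>lborel) =
        (\<integral>\<^sup>+x. indicator A x * W (x - s *\<^sub>R e) \<partial>distr lborel borel ((+) (s *\<^sub>R e)))"
      by (simp add: lborel_distr_plus)
    also have "\<dots> = (\<integral>\<^sup>+x. indicator A (x + s *\<^sub>R e) * W x \<partial>lborel)"
      by (subst nn_integral_distr) (auto simp: add.commute)
    finally show "(\<integral>\<^sup>+x. indicator A x * W (x - s *\<^sub>R e) \<partial>lborel) =
        (\<integral>\<^sup>+x. indicator A (x + s *\<^sub>R e) * W x \<partial>lborel)" .
  qed
  also have "\<dots> = (\<integral>\<^sup>+x. \<integral>\<^sup>+s. indicator A (x + s *\<^sub>R e) * W x \<partial>lborel \<partial>lborel)"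
    by (rule lborel_pair.Fubini'[symmetric]) measurable
  also have "\<dots> = (\<integral>\<^sup>+x. W x * emeasure lborel {s. x + s *\<^sub>R e \<in> A} \<partial>lborel)"
  proof (rule nn_integral_cong)
    fix x
    have "(\<integral>\<^sup>+s. indicator A (x + s *\<^sub>R e) * W x \<partial>lborel) =
        (\<integral>\<^sup>+s. W x * indicator {s. x + s *\<^sub>R e \<in> A} s \<partial>lborel)"
      by (intro nn_integral_cong) (auto simp: indicator_def)
    also have "\<dots> = W x * emeasure lborel {s. x + s *\<^sub>R e \<in> A}"
      by (rule nn_integral_cmult_indicator) measurable
    finally show "(\<integral>\<^sup>+s. indicator A (x + s *\<^sub>R e) * W x \<partial>lborel) =
        W x * emeasure lborel {s. x + s *\<^sub>R e \<in> A}" .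
  qed
  finally show ?thesis
    by (simp add: W_def e_def)
qed

text \<open>Coordinate \<open>k\<close> ranges over the same unit interval as the weight in
  \<open>emeasure_fibre\<close>, so the volume is that of the base cube of side \<open>2 * r\<close>
  in the other coordinates.\<close>

definition slab_box :: "'d \<Rightarrow> real \<Rightarrow> ('d \<Rightarrow> real) \<Rightarrow> (real ^ 'd::finite) set" where
  "slab_box k r a = {x. (0 \<le> x $ k \<and> x $ k \<le> 1) \<and> (\<forall>i\<in>UNIV - {k}. \<bar>x $ i - a i\<bar> \<le> r)}"

lemma slab_box_eq_cbox:
  "slab_box k r a = cbox (\<chi> i. if i = k then 0 else a i - r) (\<chi> i. if i = k then 1 else a i + r)"
proof (rule set_eqI)
  fix x :: "real ^ 'a"
  have "x \<in> cbox (\<chi> i. if i = k then 0 else a i - r) (\<chi> i. if i = k then 1 else a i + r) \<longleftrightarrow>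
      (\<forall>i\<in>insert k (UNIV - {k}). (if i = k then 0 else a i - r) \<le> x $ i \<and> x $ i \<le> (if i = k then 1 else a i + r))"
    unfolding mem_box_cart by auto
  also have "\<dots> \<longleftrightarrow> (0 \<le> x $ k \<and> x $ k \<le> 1) \<and> (\<forall>i\<in>UNIV - {k}. a i - r \<le> x $ i \<and> x $ i \<le> a i + r)"
    unfolding ball_insert by (intro arg_cong2[where f = "(\<and>)"] ball_cong) auto
  finally show "x \<in> slab_box k r a \<longleftrightarrow> x \<in> cbox (\<chi> i. if i = k then 0 else a i - r) (\<chi> i. if i = k then 1 else a i + r)"
    by (auto simp: slab_box_def abs_le_iff algebra_simps)
qed

lemma sets_slab_box [measurable]: "slab_box k r a \<in> sets borel"
  by (simp add: slab_box_eq_cbox)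

lemma emeasure_slab_box:
  fixes k :: "'d::finite"
  assumes "0 \<le> r"
  shows "emeasure lborel (slab_box k r a) = ennreal ((2 * r) ^ (CARD('d) - 1))"
proof -
  have "emeasure lborel (slab_box k r a) =
      measure lborel (cbox (\<chi> i. if i = k then 0 else a i - r) (\<chi> i. if i = k then 1 else a i + r))"
    unfolding slab_box_eq_cbox
    by (intro emeasure_eq_ennreal_measure less_imp_neq emeasure_lborel_cbox_finite[unfolded infinity_ennreal_def])
  also have "measure lborel (cbox (\<chi> i. if i = k then 0 else a i - r) (\<chi> i. if i = k then 1 else a i + r))
      = (\<Prod>i\<in>UNIV. (if i = k then 1 else a i + r) - (if i = k then 0 else a i - r))"
    using assms
    by (subst content_cbox_cart) (auto simp: interval_eq_empty_cart not_less split: if_splits)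
  also have "\<dots> = (\<Prod>i\<in>UNIV - {k}. 2 * r)"
    by (subst prod.remove[of _ k]) (auto intro!: prod.cong)
  finally show ?thesis
    by simp
qed

text \<open>The factor \<open>CARD('d)\<close> keeps the graph away from the top face of the cube:
  the squares add up to at most \<open>CARD('d) - 1\<close>, which leaves room above the graph for
  the caps.\<close>

definition paraboloid :: "'d \<Rightarrow> (real ^ 'd::finite) set" where
  "paraboloid k = {x \<in> unit_cube. (\<Sum>i\<in>UNIV - {k}. (x $ i)\<^sup>2) \<le> real CARD('d) * x $ k}"

text \<open>The function whose zero set is the tangent hyperplane of the paraboloid over \<open>a\<close>.\<close>

definition tangent_gap :: "'d \<Rightarrow> ('d \<Rightarrow> real) \<Rightarrow> real ^ 'd::finite \<Rightarrow> real" where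
  "tangent_gap k a x = real CARD('d) * x $ k - (\<Sum>i\<in>UNIV - {k}. 2 * a i * x $ i - (a i)\<^sup>2)"

text \<open>The height \<open>h\<close> is measured by \<open>tangent_gap\<close>, so vertically it
  is \<open>h / CARD('d)\<close>. The strict inequality makes what remains after removal
  closed.\<close>

definition cap :: "'d \<Rightarrow> real \<Rightarrow> ('d \<Rightarrow> real) \<Rightarrow> (real ^ 'd::finite) set" where
  "cap k h a = {x \<in> paraboloid k. tangent_gap k a x < h}"

text \<open>Completing the square at \<open>a\<close>: relative to its tangent hyperplane the
  paraboloid has the same equation over every \<open>a\<close>, so all caps can be treated
  alike.\<close>

lemma paraboloid_tangent_gap:
  "(\<Sum>i\<in>UNIV - {k}. (x $ i)\<^sup>2) \<le> real CARD('d) * x $ k \<longleftrightarrow>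
    (\<Sum>i\<in>UNIV - {k}. (x $ i - a i)\<^sup>2) \<le> tangent_gap k a (x :: real ^ 'd::finite)"
  by (simp add: tangent_gap_def power2_diff sum.distrib sum_subtractf algebra_simps)

lemma continuous_on_tangent_gap: "continuous_on S (tangent_gap k a)"
  unfolding tangent_gap_def by (intro continuous_intros)

lemma unit_cube_eq_cbox: "unit_cube = cbox 0 (1 :: real ^ 'd::finite)"
  by (auto simp: unit_cube_def mem_box_cart)

section \<open>Convexity and compactness of the truncated paraboloids\<close>

lemma compact_paraboloid: "compact (paraboloid k)"
proof -
  have "paraboloid k = unit_cube \<inter> {x. (\<Sum>i\<in>UNIV - {k}. (x $ i)\<^sup>2) \<le> real CARD('a) * x $ k}"
    by (auto simp: paraboloid_def)
  moreover have "closed {x :: real ^ 'a. (\<Sum>i\<in>UNIV - {k}. (x $ i)\<^sup>2) \<le> real CARD('a) * x $ k}"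
    by (intro closed_Collect_le continuous_intros)
  ultimately show ?thesis
    by (simp add: unit_cube_eq_cbox compact_Int_closed)
qed

lemma convex_paraboloid: "convex (paraboloid k)"
proof (rule convexI)
  fix x y :: "real ^ 'a" and u v :: real
  assume xy: "x \<in> paraboloid k" "y \<in> paraboloid k" and uv: "0 \<le> u" "0 \<le> v" "u + v = 1"
  let ?q = "\<lambda>x :: real ^ 'a. \<Sum>i\<in>UNIV - {k}. (x $ i)\<^sup>2"
  have "u *\<^sub>R x + v *\<^sub>R y \<in> unit_cube"
    using xy uv convexD[OF convex_box(1)[of 0 "1 :: real ^ 'a"], of x y u v]
    by (simp add: paraboloid_def unit_cube_eq_cbox)
  moreover have "?q (u *\<^sub>R x + v *\<^sub>R y) \<le> (\<Sum>i\<in>UNIV - {k}. u * (x $ i)\<^sup>2 + v * (y $ i)\<^sup>2)"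
  proof (rule sum_mono)
    fix i
    show "((u *\<^sub>R x + v *\<^sub>R y) $ i)\<^sup>2 \<le> u * (x $ i)\<^sup>2 + v * (y $ i)\<^sup>2"
      using convex_power2 uv by (simp add: convex_on_def)
  qed
  moreover have "(\<Sum>i\<in>UNIV - {k}. u * (x $ i)\<^sup>2 + v * (y $ i)\<^sup>2) = u * ?q x + v * ?q y"
    by (simp add: sum.distrib sum_distrib_left)
  moreover have "u * ?q x + v * ?q y \<le> u * (real CARD('a) * x $ k) + v * (real CARD('a) * y $ k)"
    using xy uv by (intro add_mono mult_left_mono) (auto simp: paraboloid_def)
  ultimately show "u *\<^sub>R x + v *\<^sub>R y \<in> paraboloid k"
    by (simp add: paraboloid_def algebra_simps)
qed

lemma tangent_gap_convex_comb:
  assumes "u + v = 1"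
  shows "tangent_gap k a (u *\<^sub>R x + v *\<^sub>R y) = u * tangent_gap k a x + v * tangent_gap k a y"
proof -
  have v: "v = 1 - u"
    using assms by simp
  show ?thesis
    unfolding tangent_gap_def v
    by (simp add: sum_distrib_left right_diff_distrib sum_subtractf sum.distrib algebra_simps)
qed

lemma convex_tangent_gap_ge: "convex {x. h \<le> tangent_gap k a x}"
proof (rule convexI)
  fix x y and u v :: real
  assume xy: "x \<in> {x. h \<le> tangent_gap k a x}" "y \<in> {x. h \<le> tangent_gap k a x}"
    and uv: "0 \<le> u" "0 \<le> v" "u + v = 1"
  have "h = u * h + v * h"
    using uv(3) by (metis distrib_right mult_1)
  also have "\<dots> \<le> u * tangent_gap k a x + v * tangent_gap k a y"
    using xy uv by (intro add_mono mult_left_mono) auto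
  finally show "u *\<^sub>R x + v *\<^sub>R y \<in> {x. h \<le> tangent_gap k a x}"
    by (simp add: tangent_gap_convex_comb uv(3))
qed

text \<open>Removing a cap amounts to intersecting with a closed half-space, which preserves
  compactness and convexity. The bound on \<open>h\<close> secures an open box that no cap reaches,
  whatever the centres in \<open>S\<close>.\<close>

lemma truncated_paraboloid_mem_convex_class:
  fixes k :: "'d::finite"
  assumes "h \<le> 1 / 4" and "CARD('d) \<ge> 2"
  shows "paraboloid k - (\<Union>a\<in>S. cap k h a) \<in> convex_class"
proof -
  have eq: "paraboloid k - (\<Union>a\<in>S. cap k h a) = paraboloid k \<inter> (\<Inter>a\<in>S. {x. h \<le> tangent_gap k a x})"
    unfolding cap_def by (auto simp: not_less[symmetric])
  have "closed (\<Inter>a\<in>S. {x :: real ^ 'd. h \<le> tangent_gap k a x})"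
    by (intro closed_INT ballI closed_Collect_le continuous_on_tangent_gap continuous_intros)
  then have cpt: "compact (paraboloid k \<inter> (\<Inter>a\<in>S. {x. h \<le> tangent_gap k a x}))"
    by (intro compact_Int_closed compact_paraboloid)
  have cvx: "convex (paraboloid k \<inter> (\<Inter>a\<in>S. {x. h \<le> tangent_gap k a x}))"
    by (intro convex_Int convex_INT convex_paraboloid convex_tangent_gap_ge)
  define B :: "(real ^ 'd) set" where
    "B = box (\<chi> i. if i = k then 1/2 else 0) (\<chi> i. if i = k then 1 else 1/4)"
  have "B \<subseteq> paraboloid k \<inter> (\<Inter>a\<in>S. {x. h \<le> tangent_gap k a x})"
  proof
    fix x assume "x \<in> B"
    then have x: "\<And>i. i \<noteq> k \<Longrightarrow> 0 < x $ i \<and> x $ i < 1 / 4" and xk: "1 / 2 < x $ k" "x $ k < 1"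
      by (auto simp: B_def mem_box_cart split: if_splits)
    have cube: "x \<in> unit_cube"
      unfolding unit_cube_def mem_Collect_eq
    proof
      fix i show "0 \<le> x $ i \<and> x $ i \<le> 1"
        using x[of i] xk by (cases "i = k") auto
    qed
    have "(\<Sum>i\<in>UNIV - {k}. (x $ i)\<^sup>2) \<le> (\<Sum>i\<in>UNIV - {k}. 1 / 16)"
    proof (rule sum_mono)
      fix i assume "i \<in> UNIV - {k}"
      then have "(x $ i)\<^sup>2 \<le> (1 / 4)\<^sup>2"
        using x[of i] by (intro power_mono) auto
      then show "(x $ i)\<^sup>2 \<le> 1 / 16"
        by (simp add: power2_eq_square)
    qed
    also have "\<dots> = (real CARD('d) - 1) / 16"
      using assms(2) by (simp add: of_nat_diff)
    finally have q: "(\<Sum>i\<in>UNIV - {k}. (x $ i)\<^sup>2) \<le> (real CARD('d) - 1) / 16" .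
    have d2: "2 \<le> real CARD('d)"
      using assms(2) by simp
    have dk: "real CARD('d) * (1 / 2) \<le> real CARD('d) * x $ k"
      using xk by (intro mult_left_mono) auto
    have "h \<le> tangent_gap k a x" for a
    proof -
      \<comment> \<open>Each tangent hyperplane lies below the paraboloid, since the difference is a
        sum of squares; this makes the estimate uniform in \<open>a\<close>.\<close>
      have "(\<Sum>i\<in>UNIV - {k}. 2 * a i * x $ i - (a i)\<^sup>2) \<le> (\<Sum>i\<in>UNIV - {k}. (x $ i)\<^sup>2)"
      proof (rule sum_mono)
        fix i show "2 * a i * x $ i - (a i)\<^sup>2 \<le> (x $ i)\<^sup>2"
          using zero_le_power2[of "x $ i - a i"] by (simp add: power2_diff mult_ac)
      qed
      \<comment> \<open>Over \<open>B\<close> the gap is at least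
        \<open>d / 2 - (d - 1) / 16\<close>, which exceeds 1/4 for \<open>d\<close> at least
        2.\<close>
      moreover have "h \<le> p - t" if "t \<le> s" "s \<le> (d - 1) / 16" "d * (1 / 2) \<le> p" "2 \<le> d" for d p s t :: real
        using that assms(1) by (simp add: field_simps)
      ultimately show ?thesis
        using q dk d2 unfolding tangent_gap_def by blast
    qed
    moreover have "x \<in> paraboloid k"
    proof -
      have "s \<le> p" if "s \<le> (d - 1) / 16" "d * (1 / 2) \<le> p" "2 \<le> d" for d p s :: real
        using that by (simp add: field_simps)
      then have "(\<Sum>i\<in>UNIV - {k}. (x $ i)\<^sup>2) \<le> real CARD('d) * x $ k"
        using q dk d2 by blast
      then show ?thesis
        using cube by (simp add: paraboloid_def)
    qed
    ultimately show "x \<in> paraboloid k \<inter> (\<Inter>a\<in>S. {x. h \<le> tangent_gap k a x})"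
      by auto
  qed
  moreover have "B \<noteq> {}"
    by (auto simp: B_def interval_eq_empty_cart not_le split: if_splits)
  moreover have "open B"
    unfolding B_def by (rule open_box)
  ultimately have "interior (paraboloid k \<inter> (\<Inter>a\<in>S. {x. h \<le> tangent_gap k a x})) \<noteq> {}"
    using interior_maximal by blast
  moreover have "paraboloid k \<subseteq> unit_cube"
    by (auto simp: paraboloid_def)
  ultimately show ?thesis
    using cpt cvx unfolding convex_class_def eq by blast
qed

section \<open>Location and volume of a cap\<close>

lemma sets_cap [measurable]: "cap k h a \<in> sets borel"
proof -
  have "open {x. tangent_gap k a x < h}"
    by (intro open_Collect_less continuous_on_tangent_gap continuous_intros)
  moreover have "cap k h a = paraboloid k \<inter> {x. tangent_gap k a x < h}"
    by (auto simp: cap_def)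
  moreover have "closed (paraboloid k)"
    by (rule compact_imp_closed[OF compact_paraboloid])
  ultimately show ?thesis
    by auto
qed

lemma abs_less_of_sum_power2_less:
  fixes y :: "'i \<Rightarrow> real"
  assumes "finite I" "i \<in> I" "(\<Sum>i\<in>I. (y i)\<^sup>2) < r\<^sup>2" "0 \<le> r"
  shows "\<bar>y i\<bar> < r"
proof -
  have "(y i)\<^sup>2 \<le> (\<Sum>i\<in>I. (y i)\<^sup>2)"
    using assms(1,2) by (intro member_le_sum) auto
  then have "\<bar>y i\<bar>\<^sup>2 < r\<^sup>2"
    using assms(3) by simp
  then show ?thesis
    using assms(4) power2_less_imp_less by blast
qed

text \<open>Inside the paraboloid the gap dominates the squared horizontal distance to
  \<open>a\<close>, so a gap below \<open>r\<^sup>2\<close> confines the cap to a cylinder of radius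
  \<open>r\<close>. This is what separates caps with distant centres.\<close>

lemma cap_imp_abs_less:
  assumes "x \<in> cap k (r\<^sup>2) a" "0 \<le> r" "i \<noteq> k"
  shows "\<bar>x $ i - a i\<bar> < r"
proof -
  have "(\<Sum>i\<in>UNIV - {k}. (x $ i - a i)\<^sup>2) < r\<^sup>2"
    using assms(1) paraboloid_tangent_gap[of x k a] by (auto simp: cap_def paraboloid_def)
  then show ?thesis
    using abs_less_of_sum_power2_less[of "UNIV - {k}" i "\<lambda>i. x $ i - a i" r] assms by auto
qed

text \<open>When the centre is at distance at least \<open>r\<close> from the side faces, the cube
  constraints hold automatically. The cap is then the region between two graphs, with explicit
  fibres.\<close>

lemma cap_eq:
  fixes k :: "'d::finite"
  assumes r: "0 \<le> r" "r \<le> 1" and a: "\<And>i. i \<noteq> k \<Longrightarrow> r \<le> a i \<and> a i \<le> 1 - r"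
  shows "cap k (r\<^sup>2) a = {x. (\<Sum>i\<in>UNIV - {k}. (x $ i - a i)\<^sup>2) \<le> tangent_gap k a x \<and> tangent_gap k a x < r\<^sup>2}"
    (is "_ = ?R")
proof
  show "cap k (r\<^sup>2) a \<subseteq> ?R"
    by (auto simp: cap_def paraboloid_def simp flip: paraboloid_tangent_gap)
  show "?R \<subseteq> cap k (r\<^sup>2) a"
  proof
    fix x assume x: "x \<in> ?R"
    have i: "\<bar>x $ i - a i\<bar> < r" if "i \<noteq> k" for i
      using abs_less_of_sum_power2_less[of "UNIV - {k}" i "\<lambda>i. x $ i - a i" r] that x r by auto
    have xi: "0 \<le> x $ i \<and> x $ i \<le> 1" if "i \<noteq> k" for i
      using i[OF that] a[OF that] by auto
    have q: "(\<Sum>i\<in>UNIV - {k}. (x $ i)\<^sup>2) \<le> real CARD('d) * x $ k"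
      using x paraboloid_tangent_gap[of x k a] by simp
    moreover have "0 \<le> (\<Sum>i\<in>UNIV - {k}. (x $ i)\<^sup>2)"
      by (intro sum_nonneg) auto
    ultimately have "0 \<le> real CARD('d) * x $ k"
      by linarith
    then have "0 \<le> x $ k"
      by (simp add: zero_le_mult_iff)
    \<comment> \<open>The tangent hyperplane contributes at most \<open>CARD('d) - 1\<close>, so a
      gap below one forces \<open>x $ k\<close> to be at most one.\<close>
    have "(\<Sum>i\<in>UNIV - {k}. 2 * a i * x $ i - (a i)\<^sup>2) \<le> (\<Sum>i\<in>UNIV - {k}. 1)"
    proof (rule sum_mono)
      fix i assume "i \<in> UNIV - {k}"
      then have "(x $ i)\<^sup>2 \<le> 1"
        using xi[of i] by (simp add: power_le_one)
      then show "2 * a i * x $ i - (a i)\<^sup>2 \<le> 1"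
        using zero_le_power2[of "x $ i - a i"] by (simp add: power2_diff mult_ac)
    qed
    also have "\<dots> = real CARD('d) - 1"
      by (simp add: of_nat_diff Suc_le_eq)
    moreover have "r\<^sup>2 \<le> 1"
      using r by (simp add: power_le_one)
    moreover have "tangent_gap k a x < r\<^sup>2"
      using x by simp
    ultimately have "real CARD('d) * x $ k \<le> real CARD('d) * 1"
      unfolding tangent_gap_def by linarith
    then have "x $ k \<le> 1"
      by (simp add: mult_le_cancel_left_pos)
    have "x \<in> unit_cube"
      unfolding unit_cube_def mem_Collect_eq
    proof
      fix i show "0 \<le> x $ i \<and> x $ i \<le> 1"
        using xi[of i] \<open>0 \<le> x $ k\<close> \<open>x $ k \<le> 1\<close> by (cases "i = k") auto
    qed
    then show "x \<in> cap k (r\<^sup>2) a"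
      using x q by (simp add: cap_def paraboloid_def)
  qed
qed

text \<open>A shift by \<open>s\<close> along axis \<open>k\<close> adds \<open>CARD('d) * s\<close>
  to the gap and keeps the horizontal distance, so the fibre is a half-open interval. Where the
  fibre is empty the right-hand side is still correct, because \<open>ennreal\<close> sends negative
  reals to zero.\<close>

lemma emeasure_cap_fibre:
  fixes k :: "'d::finite"
  assumes r: "0 \<le> r" "r \<le> 1" and a: "\<And>i. i \<noteq> k \<Longrightarrow> r \<le> a i \<and> a i \<le> 1 - r"
  shows "emeasure lborel {s. x + s *\<^sub>R axis k 1 \<in> cap k (r\<^sup>2) a} =
    ennreal ((r\<^sup>2 - (\<Sum>i\<in>UNIV - {k}. (x $ i - a i)\<^sup>2)) / real CARD('d))"
proof -
  define q where "q = (\<Sum>i\<in>UNIV - {k}. (x $ i - a i)\<^sup>2)"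
  define d where "d = real CARD('d)"
  have "0 < d"
    by (simp add: d_def)
  have "(\<Sum>i\<in>UNIV - {k}. ((x + s *\<^sub>R axis k 1) $ i - a i)\<^sup>2) = q" for s
    unfolding q_def by (intro sum.cong) (auto simp: axis_def)
  moreover have "tangent_gap k a (x + s *\<^sub>R axis k 1) = tangent_gap k a x + d * s" for s
  proof -
    have "(\<Sum>i\<in>UNIV - {k}. 2 * a i * (x + s *\<^sub>R axis k 1) $ i - (a i)\<^sup>2) =
        (\<Sum>i\<in>UNIV - {k}. 2 * a i * x $ i - (a i)\<^sup>2)"
      by (intro sum.cong) (auto simp: axis_def)
    then show ?thesis
      by (simp add: tangent_gap_def d_def axis_def algebra_simps)
  qed
  ultimately have "{s. x + s *\<^sub>R axis k 1 \<in> cap k (r\<^sup>2) a} =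
      {(q - tangent_gap k a x) / d..<(r\<^sup>2 - tangent_gap k a x) / d}"
    using \<open>0 < d\<close> by (subst cap_eq[OF assms]) (auto simp: field_simps)
  moreover have "emeasure lborel {u..<v} = ennreal (v - u)" for u v :: real
    by (cases "u \<le> v") (auto simp: ennreal_neg)
  ultimately show ?thesis
    by (simp add: q_def d_def diff_divide_distrib)
qed

text \<open>Fibres have length at most \<open>r\<^sup>2 / CARD('d)\<close> and vanish outside the
  cube circumscribed about the base ball.\<close>

lemma emeasure_cap_le:
  fixes k :: "'d::finite"
  assumes r: "0 \<le> r" "r \<le> 1" and a: "\<And>i. i \<noteq> k \<Longrightarrow> r \<le> a i \<and> a i \<le> 1 - r"
  shows "emeasure lborel (cap k (r\<^sup>2) a) \<le> ennreal (r\<^sup>2 / real CARD('d) * (2 * r) ^ (CARD('d) - 1))"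
proof -
  define q where "q x = (\<Sum>i\<in>UNIV - {k}. (x $ i - a i)\<^sup>2)" for x :: "real ^ 'd"
  have "emeasure lborel (cap k (r\<^sup>2) a) =
      (\<integral>\<^sup>+x. indicator {x. 0 \<le> x $ k \<and> x $ k \<le> 1} x * ennreal ((r\<^sup>2 - q x) / real CARD('d)) \<partial>lborel)"
    unfolding q_def by (subst emeasure_fibre[where k = k]) (simp_all add: emeasure_cap_fibre[OF assms])
  also have "\<dots> \<le> (\<integral>\<^sup>+x. ennreal (r\<^sup>2 / real CARD('d)) * indicator (slab_box k r a) x \<partial>lborel)"
  proof (rule nn_integral_mono)
    fix x :: "real ^ 'd"
    show "indicator {x. 0 \<le> x $ k \<and> x $ k \<le> 1} x * ennreal ((r\<^sup>2 - q x) / real CARD('d))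
        \<le> ennreal (r\<^sup>2 / real CARD('d)) * indicator (slab_box k r a) x"
    proof (cases "q x < r\<^sup>2")
      case True
      have "\<bar>x $ i - a i\<bar> \<le> r" if "i \<in> UNIV - {k}" for i
        using abs_less_of_sum_power2_less[of "UNIV - {k}" i "\<lambda>i. x $ i - a i" r] that True r
        by (auto simp: q_def)
      moreover have "0 \<le> q x"
        unfolding q_def by (intro sum_nonneg) auto
      ultimately show ?thesis
        by (auto simp: indicator_def slab_box_def intro!: ennreal_leI divide_right_mono)
    next
      case False
      then have "ennreal ((r\<^sup>2 - q x) / real CARD('d)) = 0"
        by (intro ennreal_neg) (auto simp: divide_nonpos_nonneg)
      then show ?thesis
        by simp
    qed
  qed
  also have "\<dots> = ennreal (r\<^sup>2 / real CARD('d) * (2 * r) ^ (CARD('d) - 1))"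
    using r by (subst nn_integral_cmult_indicator) (simp_all add: emeasure_slab_box ennreal_mult'[symmetric])
  finally show ?thesis .
qed

text \<open>Over an inscribed cube at least half of the maximal height remains. Its half-side
  \<open>\<rho>\<close> solves \<open>CARD('d) * \<rho>\<^sup>2 = r\<^sup>2 / 2\<close>, which
  bounds the squared distance to the centre by \<open>r\<^sup>2 / 2\<close>.\<close>

lemma emeasure_cap_ge:
  fixes k :: "'d::finite"
  assumes r: "0 \<le> r" "r \<le> 1" and a: "\<And>i. i \<noteq> k \<Longrightarrow> r \<le> a i \<and> a i \<le> 1 - r"
  shows "ennreal (r\<^sup>2 / (2 * real CARD('d)) * (2 * (r / sqrt (2 * real CARD('d)))) ^ (CARD('d) - 1))
    \<le> emeasure lborel (cap k (r\<^sup>2) a)"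
proof -
  define q where "q x = (\<Sum>i\<in>UNIV - {k}. (x $ i - a i)\<^sup>2)" for x :: "real ^ 'd"
  define \<rho> where "\<rho> = r / sqrt (2 * real CARD('d))"
  have \<rho>: "0 \<le> \<rho>" "\<rho>\<^sup>2 = r\<^sup>2 / (2 * real CARD('d))"
    using r by (auto simp: \<rho>_def power_divide)
  have "ennreal (r\<^sup>2 / (2 * real CARD('d)) * (2 * \<rho>) ^ (CARD('d) - 1)) =
      (\<integral>\<^sup>+x. ennreal (r\<^sup>2 / (2 * real CARD('d))) * indicator (slab_box k \<rho> a) x \<partial>lborel)"
    using r \<rho> by (subst nn_integral_cmult_indicator) (simp_all add: emeasure_slab_box ennreal_mult'[symmetric])
  also have "\<dots> \<le> (\<integral>\<^sup>+x. indicator {x. 0 \<le> x $ k \<and> x $ k \<le> 1} x *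
      ennreal ((r\<^sup>2 - q x) / real CARD('d)) \<partial>lborel)"
  proof (rule nn_integral_mono)
    fix x :: "real ^ 'd"
    show "ennreal (r\<^sup>2 / (2 * real CARD('d))) * indicator (slab_box k \<rho> a) x
        \<le> indicator {x. 0 \<le> x $ k \<and> x $ k \<le> 1} x * ennreal ((r\<^sup>2 - q x) / real CARD('d))"
    proof (cases "x \<in> slab_box k \<rho> a")
      case True
      have "q x \<le> (\<Sum>i\<in>UNIV - {k}. \<rho>\<^sup>2)"
        unfolding q_def
      proof (rule sum_mono)
        fix i assume "i \<in> UNIV - {k}"
        then have "\<bar>x $ i - a i\<bar>\<^sup>2 \<le> \<rho>\<^sup>2"
          using True by (intro power_mono) (auto simp: slab_box_def)
        then show "(x $ i - a i)\<^sup>2 \<le> \<rho>\<^sup>2"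
          by simp
      qed
      also have "\<dots> \<le> real CARD('d) * \<rho>\<^sup>2"
        by (auto intro!: mult_right_mono)
      also have "\<dots> = r\<^sup>2 / 2"
        by (simp add: \<rho>)
      finally have "r\<^sup>2 / 2 / real CARD('d) \<le> (r\<^sup>2 - q x) / real CARD('d)"
        by (intro divide_right_mono) auto
      with True show ?thesis
        by (auto simp: indicator_def slab_box_def intro!: ennreal_leI)
    qed simp
  qed
  also have "\<dots> = emeasure lborel (cap k (r\<^sup>2) a)"
    unfolding q_def by (subst emeasure_fibre[where k = k and A = "cap k (r\<^sup>2) a"]) (simp_all add: emeasure_cap_fibre[OF assms])
  finally show ?thesis
    by (simp add: \<rho>_def)
qed

subsection \<open>Risk over a hypercube of sets\<close>

definition uniform_cube :: "(real ^ 'd::finite) measure" where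
  "uniform_cube = uniform_measure lborel unit_cube"

lemma sets_unit_cube: "unit_cube \<in> sets borel"
  by (simp add: unit_cube_eq_cbox)

lemma emeasure_unit_cube: "emeasure lborel (unit_cube :: (real ^ 'd::finite) set) = 1"
proof -
  have "emeasure lborel (unit_cube :: (real ^ 'd) set) = measure lborel (cbox 0 (1 :: real ^ 'd))"
    unfolding unit_cube_eq_cbox
    by (intro emeasure_eq_ennreal_measure less_imp_neq emeasure_lborel_cbox_finite[unfolded infinity_ennreal_def])
  also have "measure lborel (cbox 0 (1 :: real ^ 'd)) = 1"
    by (subst content_cbox_cart) (auto simp: interval_eq_empty_cart)
  finally show ?thesis
    by simp
qed

lemma sets_uniform_cube [simp, measurable_cong]: "sets uniform_cube = sets borel"
  by (simp add: uniform_cube_def)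

lemma space_uniform_cube [simp]: "space uniform_cube = UNIV"
  by (simp add: uniform_cube_def)

lemma prob_space_uniform_cube: "prob_space uniform_cube"
  unfolding uniform_cube_def by (rule prob_space_uniform_measure) (simp_all add: emeasure_unit_cube)

lemma emeasure_uniform_cube_le:
  assumes "D \<in> sets borel"
  shows "emeasure uniform_cube D \<le> emeasure lborel D"
proof -
  have "emeasure uniform_cube D = emeasure lborel (unit_cube \<inter> D)"
    unfolding uniform_cube_def using assms
    by (subst emeasure_uniform_measure) (auto simp: emeasure_unit_cube sets_unit_cube divide_ennreal_def)
  also have "\<dots> \<le> emeasure lborel D"
    using assms by (intro emeasure_mono) auto
  finally show ?thesis .
qed

section \<open>Samples for different sets built from a common design and noise\<close>

definition observe :: "(real ^ 'd::finite) set \<Rightarrow> (real ^ 'd) \<times> real \<Rightarrow> (real ^ 'd) \<times> real" where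
  "observe G = (\<lambda>(x, \<xi>). (x, indicator G x + \<xi>))"

lemma pair_measure_borel_real:
  assumes "sets N = sets (borel :: real measure)"
  shows "sets (uniform_cube \<Otimes>\<^sub>M N) = sets (borel :: ((real ^ 'd::finite) \<times> real) measure)"
  using assms by (simp add: borel_prod[symmetric] cong: sets_pair_measure_cong)

lemma measurable_observe:
  assumes [measurable]: "G \<in> sets borel" and "sets N = sets borel"
  shows "observe G \<in> borel_measurable (uniform_cube \<Otimes>\<^sub>M N)"
proof -
  have "observe G \<in> (borel \<Otimes>\<^sub>M borel) \<rightarrow>\<^sub>M (borel \<Otimes>\<^sub>M borel)"
    unfolding observe_def by measurable
  then show ?thesis
    by (simp add: borel_prod cong: measurable_cong_sets[OF pair_measure_borel_real[OF assms(2)] refl])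
qed

lemma prob_space_uniform_cube_pair:
  assumes "prob_space N"
  shows "prob_space ((uniform_cube :: (real ^ 'd::finite) measure) \<Otimes>\<^sub>M N)"
proof -
  interpret N: prob_space N by fact
  interpret U: prob_space "uniform_cube :: (real ^ 'd) measure" by (rule prob_space_uniform_cube)
  interpret pair_prob_space "uniform_cube :: (real ^ 'd) measure" N ..
  show ?thesis by unfold_locales
qed

text \<open>All sample laws live on one space: the noise and the design points do not depend on the set.\<close>

lemma sample_law_eq_distr:
  fixes G :: "(real ^ 'd::finite) set"
  assumes N: "prob_space N" "sets N = sets borel" and G: "G \<in> sets borel"
  shows "sample_law N n G =
    distr (PiM {1..n} (\<lambda>_. uniform_cube \<Otimes>\<^sub>M N)) (sample_space n) (compose {1..n} (observe G))"
proof -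
  let ?Q = "uniform_cube \<Otimes>\<^sub>M N"
  have law: "pair_law N G = distr ?Q borel (observe G)"
    by (simp add: pair_law_def uniform_cube_def observe_def)
  have obs: "observe G \<in> borel_measurable ?Q"
    by (rule measurable_observe[OF G N(2)])
  interpret Q: prob_space "?Q :: ((real ^ 'd) \<times> real) measure"
    by (rule prob_space_uniform_cube_pair[OF N(1)])
  have "sample_law N n G = PiM {1..n} (\<lambda>_. distr ?Q (pair_law N G) (observe G))"
    unfolding sample_law_def by (intro PiM_cong refl) (simp add: law cong: distr_cong)
  \<comment> \<open>A product of image measures is the image of the product measure under the
    coordinatewise map; \<open>compose\<close> also keeps the value \<open>undefined\<close> outside
    \<open>{1..n}\<close>, as the product space demands.\<close>
  also have "\<dots> = distr (PiM {1..n} (\<lambda>_. ?Q)) (PiM {1..n} (\<lambda>_. pair_law N G)) (compose {1..n} (observe G))"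
    using Q.prob_space_distr[OF obs] obs
    by (intro distr_PiM_finite_prob_space'[symmetric] Q.prob_space_axioms)
       (auto simp: law cong: measurable_cong_sets)
  also have "\<dots> = distr (PiM {1..n} (\<lambda>_. ?Q)) (sample_space n) (compose {1..n} (observe G))"
    by (intro distr_cong refl sets_PiM_cong) (simp add: law)
  finally show ?thesis .
qed

lemma measurable_compose_observe:
  fixes G :: "(real ^ 'd::finite) set"
  assumes N: "sets N = sets borel" and G: "G \<in> sets borel"
  shows "compose {1..n} (observe G) \<in> PiM {1..n} (\<lambda>_. uniform_cube \<Otimes>\<^sub>M N) \<rightarrow>\<^sub>M sample_space n"
proof -
  note [measurable] = measurable_observe[OF G N]
  show ?thesis
    unfolding compose_def by measurable
qed

text \<open>By independence the probability is at least \<open>(1 - v) ^ n\<close>, and Bernoulli's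
  inequality bounds this below by \<open>1 - n * v\<close>.\<close>

lemma prob_avoid:
  fixes N :: "real measure" and D :: "(real ^ 'd::finite) set"
  assumes N: "prob_space N" "sets N = sets borel" and D: "D \<in> sets borel"
    and small: "emeasure lborel D \<le> ennreal v" "0 \<le> v" "real n * v \<le> 1 / 2"
  shows "ennreal (1 / 2) \<le>
    emeasure (PiM {1..n} (\<lambda>_. uniform_cube \<Otimes>\<^sub>M N)) (PiE {1..n} (\<lambda>_. (- D) \<times> UNIV))"
proof (cases "n = 0")
  case True
  have "ennreal (1 / 2) \<le> ennreal 1"
    by (intro ennreal_leI) simp
  then show ?thesis
    using True by (simp add: PiM_empty)
next
  case False
  interpret N: prob_space N by fact
  interpret U: prob_space "uniform_cube :: (real ^ 'd) measure" by (rule prob_space_uniform_cube)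
  interpret Q: prob_space "uniform_cube \<Otimes>\<^sub>M N :: ((real ^ 'd) \<times> real) measure"
    by (rule prob_space_uniform_cube_pair[OF N(1)])
  interpret P: product_sigma_finite "\<lambda>_ :: nat. uniform_cube \<Otimes>\<^sub>M N :: ((real ^ 'd) \<times> real) measure" ..
  have space_N: "space N = UNIV"
    using sets_eq_imp_space_eq[OF N(2)] by simp
  have UN: "UNIV \<in> sets N"
    by (simp add: N(2))
  \<comment> \<open>A positive \<open>n\<close> turns the bound on \<open>n * v\<close> into one on
    \<open>v\<close> itself, so that \<open>1 - v\<close> is nonnegative. The empty sample was
    therefore treated apart.\<close>
  have "real n * v \<ge> 1 * v"
    using False small(2) by (intro mult_right_mono) auto
  then have v: "v \<le> 1 / 2"
    using small(3) by simp
  have "emeasure uniform_cube D \<le> ennreal v"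
    using emeasure_uniform_cube_le[OF D] small(1) by (rule order_trans)
  then have "U.prob D \<le> v"
    using small(2) by (simp add: U.emeasure_eq_measure)
  then have "1 - v \<le> U.prob (- D)"
    using U.prob_compl[of D] D by (simp add: Compl_eq_Diff_UNIV)
  then have "ennreal (1 - v) \<le> emeasure uniform_cube (- D)"
    by (simp add: U.emeasure_eq_measure)
  also have "\<dots> = emeasure (uniform_cube \<Otimes>\<^sub>M N) ((- D) \<times> UNIV)"
    using D UN N.emeasure_space_1 by (subst N.emeasure_pair_measure_Times) (auto simp: space_N)
  finally have "ennreal (1 - v) ^ n \<le> emeasure (uniform_cube \<Otimes>\<^sub>M N) ((- D) \<times> UNIV) ^ n"
    by (intro power_mono) auto
  also have "\<dots> = emeasure (PiM {1..n} (\<lambda>_. uniform_cube \<Otimes>\<^sub>M N)) (PiE {1..n} (\<lambda>_. (- D) \<times> UNIV))"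
    using D UN by (subst P.emeasure_PiM) auto
  finally have "ennreal ((1 - v) ^ n) \<le> \<dots>"
    using v by (simp add: ennreal_power)
  moreover have "1 + real n * (- v) \<le> (1 + (- v)) ^ n"
    using v by (intro Bernoulli_inequality) auto
  then have "1 / 2 \<le> (1 - v) ^ n"
    using small(3) by simp
  ultimately show ?thesis
    by (meson ennreal_leI order_trans)
qed

text \<open>Two-point bound by coupling: as long as no design point hits \<open>D\<close>, the sample is the same
  function of design and noise under \<open>G\<close> and \<open>G - D\<close>, and no estimate is right on \<open>D\<close> for both.\<close>

lemma two_point_bound:
  fixes N :: "real measure" and D G :: "(real ^ 'd::finite) set"
    and \<Psi> :: "(real ^ 'd) set \<Rightarrow> (nat \<Rightarrow> (real ^ 'd) \<times> real) \<Rightarrow> ennreal"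
  assumes N: "prob_space N" "sets N = sets borel" and D: "D \<in> sets borel" and G: "G \<in> sets borel"
    and small: "emeasure lborel D \<le> ennreal v" "0 \<le> v" "real n * v \<le> 1 / 2"
    and \<Psi>: "\<Psi> G \<in> borel_measurable (sample_space n)" "\<Psi> (G - D) \<in> borel_measurable (sample_space n)"
    and sep: "\<And>\<omega>. \<omega> \<in> space (sample_space n) \<Longrightarrow> c \<le> \<Psi> G \<omega> + \<Psi> (G - D) \<omega>"
  shows "c * ennreal (1 / 2) \<le>
    (\<integral>\<^sup>+\<omega>. \<Psi> G \<omega> \<partial>sample_law N n G) + (\<integral>\<^sup>+\<omega>. \<Psi> (G - D) \<omega> \<partial>sample_law N n (G - D))"
proof -
  let ?M = "PiM {1..n} (\<lambda>_. uniform_cube \<Otimes>\<^sub>M N) :: (nat \<Rightarrow> (real ^ 'd) \<times> real) measure"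
  let ?E = "PiE {1..n} (\<lambda>_. (- D) \<times> UNIV) :: (nat \<Rightarrow> (real ^ 'd) \<times> real) set"
  have GD: "G - D \<in> sets borel"
    using D G by auto
  note meas = measurable_compose_observe[OF N(2)]
  have UN: "UNIV \<in> sets N"
    by (simp add: N(2))
  have E: "?E \<in> sets ?M"
    using D UN by (intro sets_PiM_I_finite) auto
  have "c * ennreal (1 / 2) \<le> c * emeasure ?M ?E"
    by (intro mult_left_mono prob_avoid[OF N D small]) auto
  also have "\<dots> = (\<integral>\<^sup>+\<omega>. c * indicator ?E \<omega> \<partial>?M)"
    using E by (simp add: nn_integral_cmult_indicator)
  also have "\<dots> \<le> (\<integral>\<^sup>+\<omega>. \<Psi> G (compose {1..n} (observe G) \<omega>) +
      \<Psi> (G - D) (compose {1..n} (observe (G - D)) \<omega>) \<partial>?M)"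
  proof (rule nn_integral_mono)
    fix \<omega> assume \<omega>: "\<omega> \<in> space ?M"
    show "c * indicator ?E \<omega> \<le> \<Psi> G (compose {1..n} (observe G) \<omega>) +
      \<Psi> (G - D) (compose {1..n} (observe (G - D)) \<omega>)"
    proof (cases "\<omega> \<in> ?E")
      case True
      \<comment> \<open>The indicators of \<open>G\<close> and \<open>G - D\<close> agree off
        \<open>D\<close>, hence at every design point of a sample in the avoiding event.\<close>
      have "compose {1..n} (observe G) \<omega> = compose {1..n} (observe (G - D)) \<omega>"
      proof
        fix i
        have "fst (\<omega> i) \<notin> D" if "i \<in> {1..n}"
          using PiE_mem[OF True that] by auto
        then show "compose {1..n} (observe G) \<omega> i = compose {1..n} (observe (G - D)) \<omega> i"
          by (auto simp: compose_def observe_def indicator_def split: prod.splits)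
      qed
      then show ?thesis
        using True sep[OF measurable_space[OF meas[OF G] \<omega>]] by simp
    qed simp
  qed
  also have "\<dots> = (\<integral>\<^sup>+\<omega>. \<Psi> G (compose {1..n} (observe G) \<omega>) \<partial>?M) +
      (\<integral>\<^sup>+\<omega>. \<Psi> (G - D) (compose {1..n} (observe (G - D)) \<omega>) \<partial>?M)"
    using measurable_compose[OF meas[OF G] \<Psi>(1)] measurable_compose[OF meas[OF GD] \<Psi>(2)]
    by (rule nn_integral_add)
  also have "\<dots> = (\<integral>\<^sup>+\<omega>. \<Psi> G \<omega> \<partial>sample_law N n G) + (\<integral>\<^sup>+\<omega>. \<Psi> (G - D) \<omega> \<partial>sample_law N n (G - D))"
    using meas[OF G] meas[OF GD] \<Psi> by (simp add: sample_law_eq_distr N G GD nn_integral_distr)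
  finally show ?thesis .
qed

section \<open>Averaging over the vertices of the hypercube\<close>

lemma measurable_emeasure_sym_diff:
  fixes G D :: "(real ^ 'd::finite) set"
  assumes est: "set_estimator n Ghat" and [measurable]: "G \<in> sets borel" "D \<in> sets borel"
  shows "(\<lambda>\<omega>. emeasure lborel (D \<inter> sym_diff G (Ghat \<omega>))) \<in> borel_measurable (sample_space n)"
proof -
  obtain f :: "(real ^ 'd) \<times> (nat \<Rightarrow> (real ^ 'd) \<times> real) \<Rightarrow> real"
    where f [measurable]: "f \<in> borel_measurable (borel \<Otimes>\<^sub>M sample_space n)"
      and fG: "\<And>\<omega> x. \<omega> \<in> space (sample_space n) \<Longrightarrow> indicator (Ghat \<omega>) x = f (x, \<omega>)"
    using est unfolding set_estimator_def by blast
  \<comment> \<open>The local loss is written as an integral over \<open>x\<close> of a function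
    jointly measurable in \<open>x\<close> and the sample, so its measurability follows from that of
    parameter integrals.\<close>
  have "(\<lambda>\<omega>. \<integral>\<^sup>+x. indicator D x * ennreal \<bar>indicator G x - f (x, \<omega>)\<bar> \<partial>lborel)
      \<in> borel_measurable (sample_space n)"
    by measurable
  moreover have "(\<integral>\<^sup>+x. indicator D x * ennreal \<bar>indicator G x - f (x, \<omega>)\<bar> \<partial>lborel) =
      emeasure lborel (D \<inter> sym_diff G (Ghat \<omega>))" if \<omega>: "\<omega> \<in> space (sample_space n)" for \<omega>
  proof -
    have [measurable]: "Ghat \<omega> \<in> sets borel"
      using est \<omega> by (auto simp: set_estimator_def)
    have "(\<integral>\<^sup>+x. indicator D x * ennreal \<bar>indicator G x - f (x, \<omega>)\<bar> \<partial>lborel) =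
        (\<integral>\<^sup>+x. indicator (D \<inter> sym_diff G (Ghat \<omega>)) x \<partial>lborel)"
      unfolding fG[OF \<omega>, symmetric] by (intro nn_integral_cong) (auto simp: indicator_def)
    then show ?thesis
      by simp
  qed
  ultimately show ?thesis
    by (subst (asm) measurable_cong)
qed

text \<open>The vertices of the hypercube are paired along its edges in direction
  \<open>j\<close>.\<close>

lemma sum_Pow_remove:
  fixes f :: "'a set \<Rightarrow> 'b::comm_monoid_add"
  assumes "finite J" "j \<in> J"
  shows "(\<Sum>S\<in>Pow J. f S) = (\<Sum>S\<in>Pow (J - {j}). f S + f (insert j S))"
proof -
  have J: "Pow J = Pow (J - {j}) \<union> insert j ` Pow (J - {j})"
    using Pow_insert[of j "J - {j}"] assms(2) by (simp add: insert_absorb)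
  have "inj_on (insert j) (Pow (J - {j}))"
    by (auto simp: inj_on_def)
  then show ?thesis
    unfolding J using assms(1)
    by (subst sum.union_disjoint) (auto simp: sum.reindex sum.distrib)
qed

text \<open>The bound \<open>R\<close> dominates the average risk over all subsets of
  \<open>J\<close>, and each risk dominates the sum of the losses on the disjoint
  \<open>D j\<close>. In direction \<open>j\<close> there are half as many edges as vertices, and
  each edge carries loss at least \<open>w / 2\<close>; hence the average loss on \<open>D j\<close>
  is at least \<open>w / 4\<close>.\<close>

lemma assouad_bound:
  fixes D :: "'j \<Rightarrow> (real ^ 'd::finite) set" and B :: "(real ^ 'd) set"
  assumes N: "prob_space N" "sets N = sets borel" and B: "B \<in> sets borel" and J: "finite J"
    and D: "\<And>j. j \<in> J \<Longrightarrow> D j \<in> sets borel" "\<And>j. j \<in> J \<Longrightarrow> D j \<subseteq> B" "disjoint_family_on D J"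
    and upper: "\<And>j. j \<in> J \<Longrightarrow> emeasure lborel (D j) \<le> ennreal v" "0 \<le> v" "real n * v \<le> 1 / 2"
    and lower: "\<And>j. j \<in> J \<Longrightarrow> ennreal w \<le> emeasure lborel (D j)" "0 \<le> w"
    and est: "set_estimator n Ghat"
    and sup: "\<And>S. S \<subseteq> J \<Longrightarrow> risk N n (B - \<Union>(D ` S)) Ghat \<le> R"
  shows "ennreal (real (card J) * w / 4) \<le> R"
proof -
  define C where "C S = B - \<Union>(D ` S)" for S
  define \<Psi> where "\<Psi> j G \<omega> = emeasure lborel (D j \<inter> sym_diff G (Ghat \<omega>))" for j G \<omega>
  have C: "C S \<in> sets borel" if "S \<subseteq> J" for S
  proof -
    have "finite S"
      using that J by (rule finite_subset)
    then show ?thesis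
      unfolding C_def using B D(1) that by (intro sets.Diff sets.finite_UN) auto
  qed
  have \<Psi>_meas: "\<Psi> j G \<in> borel_measurable (sample_space n)" if "j \<in> J" "G \<in> sets borel" for j G
    unfolding \<Psi>_def using est that(2) D(1)[OF that(1)] by (rule measurable_emeasure_sym_diff)
  have sets_law: "sets (sample_law N n G) = sets (sample_space n)" for G :: "(real ^ 'd) set"
    unfolding sample_law_def by (intro sets_PiM_cong) (simp_all add: pair_law_def)
  have Ghat: "Ghat \<omega> \<in> sets borel" if "\<omega> \<in> space (sample_space n)" for \<omega>
    using est that by (auto simp: set_estimator_def)
  have split: "(\<Sum>j\<in>J. \<integral>\<^sup>+\<omega>. \<Psi> j (C S) \<omega> \<partial>sample_law N n (C S)) \<le> R" if S: "S \<subseteq> J" for S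
  proof -
    have "(\<Sum>j\<in>J. \<integral>\<^sup>+\<omega>. \<Psi> j (C S) \<omega> \<partial>sample_law N n (C S)) =
        (\<integral>\<^sup>+\<omega>. (\<Sum>j\<in>J. \<Psi> j (C S) \<omega>) \<partial>sample_law N n (C S))"
      using \<Psi>_meas C[OF S]
      by (intro nn_integral_sum[symmetric]) (subst measurable_cong_sets[OF sets_law refl])
    also have "\<dots> \<le> risk N n (C S) Ghat"
      unfolding risk_def
    proof (rule nn_integral_mono)
      fix \<omega> assume "\<omega> \<in> space (sample_law N n (C S))"
      then have \<omega>: "\<omega> \<in> space (sample_space n)"
        using sets_eq_imp_space_eq[OF sets_law] by blast
      have "(\<Sum>j\<in>J. \<Psi> j (C S) \<omega>) =
          emeasure lborel (\<Union>j\<in>J. D j \<inter> sym_diff (C S) (Ghat \<omega>))"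
        unfolding \<Psi>_def using D(1,3) C[OF S] Ghat[OF \<omega>] J
        by (intro sum_emeasure) (auto simp: disjoint_family_on_def)
      also have "\<dots> \<le> emeasure lborel (sym_diff (C S) (Ghat \<omega>))"
        using C[OF S] Ghat[OF \<omega>] by (intro emeasure_mono) auto
      finally show "(\<Sum>j\<in>J. \<Psi> j (C S) \<omega>) \<le> emeasure lborel (sym_diff (C S) (Ghat \<omega>))" .
    qed
    also have "\<dots> \<le> R"
      using sup[OF S] by (simp add: C_def)
    finally show ?thesis .
  qed
  have pair: "ennreal (w / 2) \<le> (\<integral>\<^sup>+\<omega>. \<Psi> j (C S) \<omega> \<partial>sample_law N n (C S)) +
      (\<integral>\<^sup>+\<omega>. \<Psi> j (C (insert j S)) \<omega> \<partial>sample_law N n (C (insert j S)))"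
    if j: "j \<in> J" and S: "S \<subseteq> J - {j}" for j S
  proof -
    have CS: "C S \<in> sets borel"
      using S by (intro C) auto
    have ins: "C (insert j S) = C S - D j"
      by (auto simp: C_def)
    have "D i \<inter> D j = {}" if "i \<in> S" for i
      using D(3) S j that by (auto simp: disjoint_family_on_def)
    then have sub: "D j \<subseteq> C S"
      using D(2)[OF j] by (auto simp: C_def)
    have "ennreal (w / 2) = ennreal w * ennreal (1 / 2)"
      by (subst ennreal_mult''[symmetric]) (use lower(2) in auto)
    also have "\<dots> \<le> (\<integral>\<^sup>+\<omega>. \<Psi> j (C S) \<omega> \<partial>sample_law N n (C S)) +
      (\<integral>\<^sup>+\<omega>. \<Psi> j (C S - D j) \<omega> \<partial>sample_law N n (C S - D j))"
    proof (rule two_point_bound[OF N D(1)[OF j] CS upper(1)[OF j] upper(2,3)])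
      show "\<Psi> j (C S) \<in> borel_measurable (sample_space n)"
        "\<Psi> j (C S - D j) \<in> borel_measurable (sample_space n)"
        by (rule \<Psi>_meas[OF j] sets.Diff CS D(1)[OF j])+
      fix \<omega> :: "nat \<Rightarrow> (real ^ 'd) \<times> real"
      assume "\<omega> \<in> space (sample_space n)"
      then have "Ghat \<omega> \<in> sets borel"
        by (rule Ghat)
      \<comment> \<open>Every point of \<open>D j\<close> belongs to \<open>C S\<close> and not to
        \<open>C S - D j\<close>, so any estimate errs there for one of the two.\<close>
      moreover have "D j = (D j \<inter> sym_diff (C S) (Ghat \<omega>)) \<union> (D j \<inter> sym_diff (C S - D j) (Ghat \<omega>))"
        using sub by auto
      ultimately have "emeasure lborel (D j) \<le> \<Psi> j (C S) \<omega> + \<Psi> j (C S - D j) \<omega>"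
        unfolding \<Psi>_def using CS D(1)[OF j]
        by (subst (1) \<open>D j = _\<close>) (intro emeasure_subadditive; auto)
      then show "ennreal w \<le> \<Psi> j (C S) \<omega> + \<Psi> j (C S - D j) \<omega>"
        using lower(1)[OF j] by (rule order_trans[rotated])
    qed
    finally show ?thesis
      by (simp add: ins)
  qed
  show ?thesis
  proof (cases "J = {}")
    case False
    \<comment> \<open>The exponent \<open>card J - 1\<close> counts the edges in one direction;
      nonemptiness of \<open>J\<close> keeps the natural subtraction exact.\<close>
    have pw: "2 ^ card J = 2 * (2 :: real) ^ (card J - 1)"
      using False J by (metis card_gt_0_iff power_minus_mult mult.commute)
    have "ennreal (2 ^ card J) * ennreal (real (card J) * w / 4) =
        ennreal (2 ^ card J * (real (card J) * w / 4))"
      by (rule ennreal_mult'[symmetric]) simp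
    also have "\<dots> = (\<Sum>j\<in>J. \<Sum>S\<in>Pow (J - {j}). ennreal (w / 2))"
    proof -
      have "(\<Sum>j\<in>J. \<Sum>S\<in>Pow (J - {j}). ennreal (w / 2)) = ennreal (\<Sum>j\<in>J. \<Sum>S\<in>Pow (J - {j}). w / 2)"
        using lower(2) by (simp add: sum_ennreal sum_nonneg del: sum_constant)
      also have "(\<Sum>j\<in>J. \<Sum>S\<in>Pow (J - {j}). w / 2) = 2 ^ card J * (real (card J) * w / 4)"
        using J by (simp add: card_Pow pw)
      finally show ?thesis by simp
    qed
    also have "\<dots> \<le> (\<Sum>j\<in>J. \<Sum>S\<in>Pow (J - {j}).
        (\<integral>\<^sup>+\<omega>. \<Psi> j (C S) \<omega> \<partial>sample_law N n (C S)) +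
        (\<integral>\<^sup>+\<omega>. \<Psi> j (C (insert j S)) \<omega> \<partial>sample_law N n (C (insert j S))))"
      by (intro sum_mono pair) auto
    also have "\<dots> = (\<Sum>j\<in>J. \<Sum>S\<in>Pow J. \<integral>\<^sup>+\<omega>. \<Psi> j (C S) \<omega> \<partial>sample_law N n (C S))"
      by (intro sum.cong refl sum_Pow_remove[symmetric] J)
    also have "\<dots> = (\<Sum>S\<in>Pow J. \<Sum>j\<in>J. \<integral>\<^sup>+\<omega>. \<Psi> j (C S) \<omega> \<partial>sample_law N n (C S))"
      by (rule sum.swap)
    also have "\<dots> \<le> (\<Sum>S\<in>Pow J. R)"
      by (intro sum_mono split) auto
    also have "\<dots> = ennreal (2 ^ card J) * R"
      using J by (simp add: card_Pow ennreal_of_nat_eq_real_of_nat)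
    finally have "ennreal (2 ^ card J) * ennreal (real (card J) * w / 4) \<le> ennreal (2 ^ card J) * R" .
    then show ?thesis
      by (subst (asm) ennreal_mult_le_mult_iff) auto
  qed simp
qed

subsection \<open>The grid of caps\<close>

text \<open>The caps are indexed by the horizontal coordinates only. Fixing the value 0 at
  \<open>k\<close> makes distinct indices differ in a horizontal coordinate.\<close>

definition grid :: "'d \<Rightarrow> nat \<Rightarrow> ('d::finite \<Rightarrow> nat) set" where
  "grid k K = PiE UNIV (\<lambda>i. if i = k then {0} else {..<K})"

text \<open>The midpoint of cell number \<open>m i\<close> when the unit interval is cut into
  \<open>K\<close> equal cells.\<close>

definition grid_point :: "nat \<Rightarrow> ('d \<Rightarrow> nat) \<Rightarrow> 'd \<Rightarrow> real" where
  "grid_point K m i = (2 * real (m i) + 1) / (2 * real K)"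

lemma finite_grid: "finite (grid k K)"
  unfolding grid_def by (intro finite_PiE) auto

lemma card_grid: "card (grid k K) = K ^ (CARD('d) - 1)" for k :: "'d::finite"
proof -
  have "card (grid k K) = (\<Prod>i\<in>UNIV. if i = k then 1 else K)"
    unfolding grid_def by (subst card_PiE) (auto intro!: prod.cong)
  also have "\<dots> = (\<Prod>i\<in>UNIV - {k}. K)"
    by (subst prod.remove[of _ k]) (auto intro!: prod.cong)
  finally show ?thesis
    by simp
qed

lemma grid_less:
  assumes "m \<in> grid k K" "i \<noteq> k"
  shows "m i < K"
  using PiE_mem[OF assms(1)[unfolded grid_def] UNIV_I, of i] assms(2) by simp

lemma grid_point_bounds:
  assumes "m \<in> grid k K" "i \<noteq> k"
  shows "1 / (2 * real K) \<le> grid_point K m i \<and> grid_point K m i \<le> 1 - 1 / (2 * real K)"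
proof -
  have "real (m i) + 1 \<le> real K"
    using grid_less[OF assms] by linarith
  moreover from this have "1 - 1 / (2 * real K) = (2 * real K - 1) / (2 * real K)"
    by (auto simp: diff_divide_distrib)
  ultimately show ?thesis
    unfolding grid_point_def by (auto intro!: divide_right_mono)
qed

text \<open>Distinct centres differ by at least \<open>1 / K\<close> in some horizontal coordinate,
  while each cap stays strictly within \<open>1 / (2 * K)\<close> of its centre.\<close>

lemma disjoint_caps:
  fixes k :: "'d::finite"
  assumes "0 < K"
  shows "disjoint_family_on (\<lambda>m. cap k ((1 / (2 * real K))\<^sup>2) (grid_point K m)) (grid k K)"
  unfolding disjoint_family_on_def
proof (intro ballI impI equals0I)
  fix m m' x
  assume m: "m \<in> grid k K" and m': "m' \<in> grid k K" and "m \<noteq> m'"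
    and x: "x \<in> cap k ((1 / (2 * real K))\<^sup>2) (grid_point K m) \<inter> cap k ((1 / (2 * real K))\<^sup>2) (grid_point K m')"
  obtain i where i: "m i \<noteq> m' i"
    using \<open>m \<noteq> m'\<close> by auto
  have "m k = m' k"
    using PiE_mem[OF m[unfolded grid_def] UNIV_I, of k] PiE_mem[OF m'[unfolded grid_def] UNIV_I, of k]
    by simp
  with i have "i \<noteq> k"
    by auto
  have "\<bar>x $ i - grid_point K m i\<bar> < 1 / (2 * real K)" "\<bar>x $ i - grid_point K m' i\<bar> < 1 / (2 * real K)"
    using x \<open>i \<noteq> k\<close> by (auto intro!: cap_imp_abs_less)
  then have "\<bar>grid_point K m i - grid_point K m' i\<bar> < 1 / (2 * real K) + 1 / (2 * real K)"
    by linarith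
  also have "grid_point K m i - grid_point K m' i = (real (m i) - real (m' i)) / real K"
    using assms by (simp add: grid_point_def field_simps)
  finally have "\<bar>real (m i) - real (m' i)\<bar> < 1"
    using assms by (simp add: abs_divide field_simps)
  with i show False
    by linarith
qed

lemma grid_size_exists:
  assumes "1 \<le> n" "0 < p"
  obtains K :: nat where "0 < K" "real n \<le> real K ^ p" "real K \<le> 2 * real n powr (1 / real p)"
proof
  define y where "y = real n powr (1 / real p)"
  have y: "1 \<le> y"
    using assms by (auto simp: y_def intro!: ge_one_powr_ge_zero)
  \<comment> \<open>Rounding up gives the lower bound on \<open>K ^ p\<close>, and it at most
    doubles \<open>y\<close> because \<open>y\<close> is at least one.\<close>
  let ?K = "nat \<lceil>y\<rceil>"
  show "0 < ?K"
    using y by simp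
  have "real n = y powr real p"
    using assms by (simp add: y_def powr_powr)
  also have "\<dots> = y ^ p"
    using y by (simp add: powr_realpow)
  also have "\<dots> \<le> real ?K ^ p"
    using y by (intro power_mono) auto
  finally show "real n \<le> real ?K ^ p" .
  have "real ?K \<le> y + 1"
    using y of_int_ceiling_le_add_one[of y] by simp
  also have "\<dots> \<le> 2 * y"
    using y by simp
  finally show "real ?K \<le> 2 * real n powr (1 / real p)"
    by (simp add: y_def)
qed

section \<open>Choice of the constants and conclusion\<close>

theorem theorem4:
  fixes \<sigma> :: real
  assumes "CARD('d::finite) \<ge> 2" and "\<sigma> > 0"
  shows "\<exists>C\<^sub>1\<^sub>7 :: real. C\<^sub>1\<^sub>7 > 0 \<and>
    (\<forall>n \<ge> (125::nat).
      \<forall>Chat :: (nat \<Rightarrow> (real ^ 'd) \<times> real) \<Rightarrow> (real ^ 'd) set.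
        set_estimator n Chat \<longrightarrow>
        (SUP C \<in> convex_class. risk (gaussian_noise \<sigma>) n C Chat)
          \<ge> ennreal (C\<^sub>1\<^sub>7 * real n powr (- 2 / (real CARD('d) + 1))))"
proof -
  define d where "d = CARD('d)"
  have d: "2 \<le> d"
    using assms(1) by (simp add: d_def)
  \<comment> \<open>With \<open>r = 1 / (2 * K)\<close> the quantity
    \<open>K ^ (d - 1) * w / 4\<close> equals
    \<open>1 / (32 * d * sqrt (2 * d) ^ (d - 1) * K\<^sup>2)\<close>. The bound on \<open>K\<close>
    by twice a power of \<open>n\<close> costs a further factor 4.\<close>
  define c where "c = 1 / (128 * real d * sqrt (2 * real d) ^ (d - 1))"
  have "0 < c"
    using d by (simp add: c_def)
  \<comment> \<open>An arbitrary coordinate serves as the vertical axis.\<close>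
  obtain k :: 'd where True
    by blast
  have N: "prob_space (gaussian_noise \<sigma>)" "sets (gaussian_noise \<sigma>) = sets borel"
    using prob_space_normal_density[OF assms(2)] by (simp_all add: gaussian_noise_def)
  show ?thesis
  proof (intro exI[of _ c] conjI allI impI \<open>0 < c\<close>)
    fix n :: nat and Chat :: "(nat \<Rightarrow> (real ^ 'd) \<times> real) \<Rightarrow> (real ^ 'd) set"
    assume n: "125 \<le> n" and est: "set_estimator n Chat"
    obtain K :: nat where K: "0 < K" "real n \<le> real K ^ (d + 1)"
      "real K \<le> 2 * real n powr (1 / real (d + 1))"
      using n by (elim grid_size_exists[rotated 2]) auto
    \<comment> \<open>Half the grid spacing: the largest radius for which the cylinders containing
      the caps neither overlap nor leave the cube sideways.\<close>
    define r where "r = 1 / (2 * real K)"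
    have r: "0 \<le> r" "r \<le> 1 / 2"
      using K(1) by (auto simp: r_def field_simps)
    then have r1: "r \<le> 1" and r2: "r\<^sup>2 \<le> 1 / 4"
      using power_mono[of r "1 / 2" 2] by (auto simp: power_divide)
    define D where "D m = cap k (r\<^sup>2) (grid_point K m)" for m
    define v where "v = r\<^sup>2 / real d * (2 * r) ^ (d - 1)"
    define w where "w = r\<^sup>2 / (2 * real d) * (2 * (r / sqrt (2 * real d))) ^ (d - 1)"
    define R where "R = (SUP C \<in> convex_class. risk (gaussian_noise \<sigma>) n C Chat)"
    have Kd: "real K ^ (d + 1) = real K ^ 2 * real K ^ (d - 1)"
      using d by (simp flip: power_add)
    \<comment> \<open>Here \<open>v\<close> is \<open>1 / (4 * d * K ^ (d + 1))\<close>, so the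
      choice of \<open>K\<close> with \<open>n\<close> at most \<open>K ^ (d + 1)\<close> makes a
      cap likely to be missed by the design.\<close>
    have "real n * v \<le> real K ^ (d + 1) * v"
      using K(2) r by (intro mult_right_mono) (auto simp: v_def)
    also have "\<dots> = 1 / (4 * real d)"
      using K(1) unfolding v_def r_def Kd by (simp add: power_divide field_simps)
    also have "\<dots> \<le> 1 / 2"
      using d by (simp add: field_simps)
    finally have nv: "real n * v \<le> 1 / 2" .
    have "ennreal (real (card (grid k K)) * w / 4) \<le> R"
    proof (rule assouad_bound[where D = D and B = "paraboloid k" and v = v, OF N])
      show "paraboloid k \<in> sets borel"
        by (intro borel_closed compact_imp_closed compact_paraboloid)
      show "disjoint_family_on D (grid k K)"
        using disjoint_caps[OF K(1), of k] by (simp add: disjoint_family_on_def D_def r_def)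
      show "risk (gaussian_noise \<sigma>) n (paraboloid k - \<Union>(D ` S)) Chat \<le> R" for S
      proof -
        have "paraboloid k - \<Union>(D ` S) \<in> convex_class"
          using truncated_paraboloid_mem_convex_class[OF r2 assms(1), of k "grid_point K ` S"]
          by (simp add: D_def)
        then show ?thesis
          unfolding R_def by (rule SUP_upper)
      qed
      fix m assume m: "m \<in> grid k K"
      show "D m \<in> sets borel"
        unfolding D_def by (rule sets_cap)
      show "D m \<subseteq> paraboloid k"
        by (auto simp: D_def cap_def)
      show "emeasure lborel (D m) \<le> ennreal v" "ennreal w \<le> emeasure lborel (D m)"
        using emeasure_cap_le[OF r(1) r1] emeasure_cap_ge[OF r(1) r1] grid_point_bounds[OF m]
        by (auto simp: D_def v_def w_def d_def r_def)
    qed (use nv r est in \<open>auto simp: finite_grid v_def w_def\<close>)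
    moreover have "c * real n powr (- 2 / (real d + 1)) \<le> real (card (grid k K)) * w / 4"
    proof -
      define y where "y = real n powr (1 / (real d + 1))"
      have y: "0 < y"
        using n by (simp add: y_def)
      have "real n powr (- 2 / (real d + 1)) = y powr (- 2)"
        by (simp add: y_def powr_powr)
      also have "\<dots> = 1 / y\<^sup>2"
        using y by (simp add: powr_minus divide_inverse)
      also have "\<dots> \<le> 1 / (real K / 2)\<^sup>2"
        using K(1,3) y by (intro divide_left_mono power_mono) (auto simp: y_def add.commute)
      finally have "c * real n powr (- 2 / (real d + 1)) \<le> c * (1 / (real K / 2)\<^sup>2)"
        using \<open>0 < c\<close> by (intro mult_left_mono) auto
      also have "\<dots> = real K ^ (d - 1) * w / 4"
        using K(1) d by (simp add: c_def w_def r_def power_divide power_mult_distrib field_simps)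
      finally show ?thesis
        by (simp add: card_grid d_def)
    qed
    ultimately show "ennreal (c * real n powr (- 2 / (real CARD('d) + 1)))
        \<le> (SUP C \<in> convex_class. risk (gaussian_noise \<sigma>) n C Chat)"
      unfolding R_def d_def by (meson ennreal_leI order_trans)
  qed
qed

end
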